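(* Let $G$ be a graph with graphical building set $\mathcal{B}(G)$. The acyclic orientations of $\mathcal{B}(G)$ are in one-to-one correspondence with the elimination forests of $G$, and the flip graph on the acyclic orientations of $\mathcal{B}(G)$ is isomorphic to the rotation graph on the elimination forests of $G$.
   Context: Graphs are finite and simple. For $G=(V,E)$, the graphical building set $\mathcal{B}(G)=(V,\mathcal{E})$ is the hypergraph with $\mathcal{E}=\{U\subseteq V\mid U\neq\emptyset,\ G[U]\text{ is connected}\}$. An orientation of a hypergraph $(V,\mathcal{E})$ is a map $h:\mathcal{E}\to V$ with $h(A)\in A$ for all $A\in\mathcal{E}$. It is acyclic if the digraph on $V$ with an arc $i\to j$ for all distinct $i,j$ such that $i,j\in A$ and $j=h(A)$ for some $A\in\mathcal{E}$ is acyclic. A pair flip of a pair $(i,j)$ of distinct vertices maps $h$ to the orientation $h'$ with $h'(A)=i$ if $h(A)=j$ and $i\in A$, and $h'(A)=h(A)$ otherwise, where $h'\ne h$ is required. The flip graph on acyclic orientations joins two acyclic orientations iff they differ in a pair flip. An elimination tree of a connected graph $G$ is an unordered rooted tree obtained by removing a vertex $v$ of $G$, which becomes the root, and recursing on the connected components of $G-v$, whose elimination trees become the subtrees of $v$. An elimination forest of a graph is a set of elimination trees, one for each connected component. With $V=[n]$, a permutation of $[n]$ produces an elimination forest by always removing, from each component, the vertex that appears leftmost in the permutation. Two distinct elimination forests differ by a rotation if there exist two permutations producing them that differ by a single adjacent transposition. The rotation graph has the elimination forests of $G$ as vertices and an edge between any two that differ by a rotation. *)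

theory Defs
  imports
    "Graph_Theory.Graph_Theory"
    "HOL-Library.FSet"
    "HOL-Library.FuncSet"
    "HOL-Combinatorics.Multiset_Permutations"
begin

section \<open>Hypergraphs, orientations and pair flips\<close>

text \<open>A hypergraph is a pair of a vertex set and a set of hyperedges.\<close>

type_synonym 'a hypergraph = "'a set \<times> 'a set set"

definition graphical_building_set :: "('a, 'b) pre_digraph \<Rightarrow> 'a hypergraph" where
  "graphical_building_set G =
     (verts G, {U. U \<subseteq> verts G \<and> U \<noteq> {} \<and> connected (G \<restriction> U)})"

text \<open>
  A map on the hyperedges is represented by a function that is \<open>undefined\<close> on all
  other sets, so that equality of functions is equality of maps.
\<close>

definition orientations :: "'a hypergraph \<Rightarrow> ('a set \<Rightarrow> 'a) set" where
  "orientations H = (\<Pi>\<^sub>E A\<in>snd H. A)"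

definition orientation_arcs :: "'a hypergraph \<Rightarrow> ('a set \<Rightarrow> 'a) \<Rightarrow> 'a rel" where
  "orientation_arcs H h = {(i, j). i \<noteq> j \<and> (\<exists>A\<in>snd H. i \<in> A \<and> j \<in> A \<and> j = h A)}"

definition acyclic_orientations :: "'a hypergraph \<Rightarrow> ('a set \<Rightarrow> 'a) set" where
  "acyclic_orientations H = {h \<in> orientations H. acyclic (orientation_arcs H h)}"

definition pair_flip ::
  "'a hypergraph \<Rightarrow> 'a \<Rightarrow> 'a \<Rightarrow> ('a set \<Rightarrow> 'a) \<Rightarrow> ('a set \<Rightarrow> 'a) \<Rightarrow> bool" where
  "pair_flip H i j h h' \<longleftrightarrow>
     i \<in> fst H \<and> j \<in> fst H \<and> i \<noteq> j \<and>
     h' = (\<lambda>A\<in>snd H. if h A = j \<and> i \<in> A then i else h A) \<and> h' \<noteq> h"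

text \<open>
  Undirected graphs are symmetric digraphs; the disjunction makes the edge relation
  symmetric by definition.
\<close>

definition flip_graph :: "'a hypergraph \<Rightarrow> ('a set \<Rightarrow> 'a) pair_pre_digraph" where
  "flip_graph H =
     \<lparr> pverts = acyclic_orientations H,
       parcs = {(h, h'). h \<in> acyclic_orientations H \<and> h' \<in> acyclic_orientations H \<and>
                  (\<exists>i j. pair_flip H i j h h' \<or> pair_flip H i j h' h)} \<rparr>"


section \<open>Elimination forests and rotations\<close>

text \<open>
  Unordered rooted trees: the subtrees of a vertex form a finite set. Sets (rather
  than multisets) suffice, since the vertex labels of an elimination tree are distinct.
\<close>

datatype 'a rtree = Node 'a "'a rtree fset"

text \<open>
  As the graphs are symmetric digraphs, their strongly connected components
  \<^const>\<open>pre_digraph.sccs\<close> are their connected components, as induced subgraphs.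
\<close>

inductive elimination_tree :: "('a, 'b) pre_digraph \<Rightarrow> 'a rtree \<Rightarrow> bool"
  and elimination_forest :: "('a, 'b) pre_digraph \<Rightarrow> 'a rtree fset \<Rightarrow> bool"
where
  tree: "\<lbrakk>connected G; v \<in> verts G; elimination_forest (pre_digraph.del_vert G v) F\<rbrakk>
    \<Longrightarrow> elimination_tree G (Node v F)"
| forest: "\<lbrakk>\<forall>C\<in>pre_digraph.sccs G. elimination_tree C (t C);
    fset F = t ` pre_digraph.sccs G\<rbrakk>
    \<Longrightarrow> elimination_forest G F"

text \<open>
  The elimination forest produced by a permutation \<open>p\<close>, given as the list of its values:
  \<open>find\<close> yields the vertex of the component that appears leftmost in \<open>p\<close>.
\<close>

inductive permutation_tree :: "'a list \<Rightarrow> ('a, 'b) pre_digraph \<Rightarrow> 'a rtree \<Rightarrow> bool"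
  and permutation_forest :: "'a list \<Rightarrow> ('a, 'b) pre_digraph \<Rightarrow> 'a rtree fset \<Rightarrow> bool"
  for p :: "'a list"
where
  tree: "\<lbrakk>connected G; find (\<lambda>v. v \<in> verts G) p = Some v;
    permutation_forest p (pre_digraph.del_vert G v) F\<rbrakk>
    \<Longrightarrow> permutation_tree p G (Node v F)"
| forest: "\<lbrakk>\<forall>C\<in>pre_digraph.sccs G. permutation_tree p C (t C);
    fset F = t ` pre_digraph.sccs G\<rbrakk>
    \<Longrightarrow> permutation_forest p G F"

definition adjacent_transposition :: "'a list \<Rightarrow> 'a list \<Rightarrow> bool" where
  "adjacent_transposition p q \<longleftrightarrow>
     (\<exists>us a b vs. p = us @ [a, b] @ vs \<and> q = us @ [b, a] @ vs)"

definition rotation :: "('a, 'b) pre_digraph \<Rightarrow> 'a rtree fset \<Rightarrow> 'a rtree fset \<Rightarrow> bool" where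
  "rotation G F F' \<longleftrightarrow> F \<noteq> F' \<and>
     (\<exists>p\<in>permutations_of_set (verts G). \<exists>q\<in>permutations_of_set (verts G).
        adjacent_transposition p q \<and> permutation_forest p G F \<and> permutation_forest q G F')"

definition rotation_graph :: "('a, 'b) pre_digraph \<Rightarrow> ('a rtree fset) pair_pre_digraph" where
  "rotation_graph G =
     \<lparr> pverts = {F. elimination_forest G F},
       parcs = {(F, F'). elimination_forest G F \<and> elimination_forest G F' \<and> rotation G F F'} \<rparr>"

end

theory Submission
  imports Defs
begin

text \<open>
  An acyclic orientation \<open>h\<close> yields an elimination forest by always removing \<open>h C\<close> from a
  component \<open>C\<close>. Acyclicity gives \<open>h A = h C\<close> whenever \<open>h C \<in> A \<subseteq> C\<close>, so the forest determines \<open>h\<close>.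
  Conversely, the depth in an elimination forest is a rank function for the orientation that it
  defines, so every elimination forest arises. Every acyclic orientation selects the leftmost vertices
  with respect to a linear extension \<open>p\<close>, and transposing two adjacent entries of \<open>p\<close> is a pair flip.
  If a flip of \<open>(i, j)\<close> preserves acyclicity, no directed path of length at least two leads from
  \<open>i\<close> to \<open>j\<close>; hence \<open>j\<close> and \<open>i\<close> can be made adjacent in a linear extension.
\<close>

section \<open>Linear extensions\<close>

text \<open>A finite nonempty set contains a sink of \<open>R\<close>; it is put first and the rest
  is sorted recursively. Arcs within \<open>S\<close> thus run from right to left, the head
  preceding the tail.\<close>

lemma acyclic_topological_sort:
  assumes "finite S" "acyclic R"
  shows "\<exists>xs. set xs = S \<and> distinct xs \<and> sorted_wrt (\<lambda>y x. (y, x) \<notin> R) xs"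
  using assms(1)
proof (induction S rule: finite_psubset_induct)
  case (psubset S)
  show ?case
  proof (cases "S = {}")
    case True
    then show ?thesis by simp
  next
    case False
    have "finite (R \<inter> S \<times> S)" using psubset.hyps by simp
    moreover have "acyclic (R \<inter> S \<times> S)" using assms(2) by (rule acyclic_subset) simp
    ultimately have "wf ((R \<inter> S \<times> S)\<inverse>)" by (rule finite_acyclic_wf_converse)
    then obtain z where z: "z \<in> S" "\<And>y. (y, z) \<in> (R \<inter> S \<times> S)\<inverse> \<Longrightarrow> y \<notin> S"
      using False by (rule wfE_min') blast
    then have sink: "(z, x) \<notin> R" if "x \<in> S" for x
      using that by blast
    have "S - {z} \<subset> S" using z(1) by blast
    then obtain xs where xs: "set xs = S - {z}" "distinct xs" "sorted_wrt (\<lambda>y x. (y, x) \<notin> R) xs"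
      using psubset.IH by blast
    have "set (z # xs) = S" using xs(1) z(1) by auto
    moreover have "distinct (z # xs)" using xs by simp
    moreover have "sorted_wrt (\<lambda>y x. (y, x) \<notin> R) (z # xs)" using xs sink by simp
    ultimately show ?thesis by blast
  qed
qed

text \<open>By \<open>no_path\<close>, no vertex is forced between \<open>j\<close> and
  \<open>i\<close>. What is reachable from \<open>i\<close> or \<open>j\<close> goes to their left,
  everything else to their right.\<close>

lemma topological_sort_adjacent:
  assumes "finite V" "acyclic R" "i \<in> V" "j \<in> V" "(i, j) \<in> R"
    and no_path: "\<And>u. (i, u) \<in> R\<^sup>+ \<Longrightarrow> (u, j) \<in> R\<^sup>+ \<Longrightarrow> False"
  shows "\<exists>us vs. us @ [j, i] @ vs \<in> permutations_of_set V \<and>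
    sorted_wrt (\<lambda>y x. (y, x) \<notin> R) (us @ [j, i] @ vs)"
proof -
  have irr: "(x, x) \<notin> R\<^sup>+" for x
    using assms(2) by (simp add: acyclic_def)
  define U where "U = {u \<in> V. u \<noteq> i \<and> u \<noteq> j \<and> ((i, u) \<in> R\<^sup>+ \<or> (j, u) \<in> R\<^sup>+)}"
  obtain us where us: "set us = U" "distinct us" "sorted_wrt (\<lambda>y x. (y, x) \<notin> R) us"
    using acyclic_topological_sort[OF _ assms(2), of U] assms(1) by (auto simp: U_def)
  obtain vs where vs: "set vs = V - U - {i, j}" "distinct vs" "sorted_wrt (\<lambda>y x. (y, x) \<notin> R) vs"
    using acyclic_topological_sort[OF _ assms(2), of "V - U - {i, j}"] assms(1) by auto
  have ne: "i \<noteq> j" using irr assms(5) by blast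
  have nU: "i \<notin> U" "j \<notin> U" by (auto simp: U_def)
  have "us @ [j, i] @ vs \<in> permutations_of_set V"
    using us vs ne nU assms(3,4) by (intro permutations_of_setI) (auto simp: U_def)
  \<comment> \<open>An arc from \<open>u\<close> to \<open>i\<close> would close a cycle, possibly
    through \<open>(i, j)\<close>; an arc from \<open>u\<close> to \<open>j\<close> would close a
    cycle or give a path from \<open>i\<close> through \<open>u\<close> to \<open>j\<close>.\<close>
  moreover have "(u, i) \<notin> R" "(u, j) \<notin> R" if "u \<in> U" for u
    using that irr no_path assms(5) unfolding U_def
    by (blast intro: trancl_into_trancl r_into_trancl)+
  \<comment> \<open>A successor of \<open>u\<close> is again reachable from \<open>i\<close> or
    \<open>j\<close>.\<close>
  moreover have "(u, v) \<notin> R" if "u \<in> U" "v \<in> V - U - {i, j}" for u v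
    using that unfolding U_def by (blast intro: trancl_into_trancl)
  moreover have "(i, v) \<notin> R" "(j, v) \<notin> R" if "v \<in> V - U - {i, j}" for v
    using that unfolding U_def by blast+
  moreover have "(j, i) \<notin> R"
    using irr assms(5) by (blast intro: trancl_into_trancl)
  ultimately have "us @ [j, i] @ vs \<in> permutations_of_set V \<and>
    sorted_wrt (\<lambda>y x. (y, x) \<notin> R) (us @ [j, i] @ vs)"
    using us vs by (auto simp: sorted_wrt_append)
  then show ?thesis by blast
qed

section \<open>Acyclic orientations of building sets\<close>

lemma find_append: "find P (xs @ ys) = (case find P xs of None \<Rightarrow> find P ys | Some x \<Rightarrow> Some x)"
  by (induction xs) auto

lemma find_SomeD: "find P xs = Some x \<Longrightarrow> x \<in> set xs \<and> P x"
  by (induction xs) (auto split: if_splits)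

text \<open>An abstraction of the connected vertex sets of a graph. Closure under unions of
  intersecting members makes the maximal members inside a set pairwise disjoint, so that they can
  play the role of components.\<close>

locale building_set =
  fixes V :: "'a set" and B :: "'a set set"
  assumes finite_V: "finite V"
    and B_subset: "A \<in> B \<Longrightarrow> A \<subseteq> V"
    and B_nonempty: "A \<in> B \<Longrightarrow> A \<noteq> {}"
    and B_union: "A \<in> B \<Longrightarrow> C \<in> B \<Longrightarrow> A \<inter> C \<noteq> {} \<Longrightarrow> A \<union> C \<in> B"
begin

lemma acyclic_orientations_mem: "h \<in> acyclic_orientations (V, B) \<Longrightarrow> A \<in> B \<Longrightarrow> h A \<in> A"
  by (auto simp: acyclic_orientations_def orientations_def PiE_def)

text \<open>Otherwise \<open>A\<close> yields the arc from \<open>h C\<close> to \<open>h A\<close>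
  and \<open>C\<close> yields the arc back, a cycle of length two.\<close>

lemma acyclic_orientation_hereditary:
  assumes h: "h \<in> acyclic_orientations (V, B)" and "A \<in> B" "C \<in> B" "A \<subseteq> C" "h C \<in> A"
  shows "h A = h C"
proof (rule ccontr)
  let ?R = "orientation_arcs (V, B) h"
  assume ne: "h A \<noteq> h C"
  have "h A \<in> A" using acyclic_orientations_mem[OF h \<open>A \<in> B\<close>] .
  with ne assms have "(h A, h C) \<in> ?R" "(h C, h A) \<in> ?R"
    unfolding orientation_arcs_def by auto
  then have "(h A, h A) \<in> ?R\<^sup>+" by (blast intro: trancl_into_trancl)
  then show False using h by (auto simp: acyclic_orientations_def acyclic_def)
qed

text \<open>Each arc strictly decreases \<open>r\<close>, so there is no cycle. The restriction to
  \<open>B\<close> supplies the value \<open>undefined\<close> elsewhere that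
  \<open>orientations\<close> demands.\<close>

lemma ranked_acyclic_orientation:
  fixes r :: "'a \<Rightarrow> nat"
  assumes "\<And>A. A \<in> B \<Longrightarrow> h A \<in> A \<and> (\<forall>x\<in>A. x \<noteq> h A \<longrightarrow> r (h A) < r x)"
  shows "restrict h B \<in> acyclic_orientations (V, B)"
proof -
  have "(orientation_arcs (V, B) (restrict h B))\<inverse> \<subseteq> measure r"
    using assms by (auto simp: orientation_arcs_def)
  then have "acyclic ((orientation_arcs (V, B) (restrict h B))\<inverse>)"
    by (meson wf_subset wf_measure wf_acyclic)
  then show ?thesis
    using assms by (auto simp: acyclic_orientations_def orientations_def)
qed

section \<open>Orientations induced by permutations\<close>

definition leftmost :: "'a list \<Rightarrow> 'a set \<Rightarrow> 'a" where
  "leftmost p = (\<lambda>A\<in>B. the (find (\<lambda>v. v \<in> A) p))"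

lemma leftmost_split:
  assumes "A \<in> B" "p \<in> permutations_of_set V"
  obtains us v vs where "leftmost p A = v" "p = us @ v # vs" "set us \<inter> A = {}" "v \<in> A"
    "find (\<lambda>v. v \<in> A) p = Some v"
proof -
  have "\<exists>v\<in>set p. v \<in> A"
    using assms B_subset[of A] B_nonempty[of A] by (auto dest: permutations_of_setD)
  then obtain us v vs where p: "p = us @ v # vs" "v \<in> A" "\<forall>u\<in>set us. u \<notin> A"
    by (rule split_list_first_propE)
  then have "find (\<lambda>v. v \<in> A) us = None" by (auto simp: find_None_iff)
  then have "find (\<lambda>v. v \<in> A) p = Some v"
    using p by (simp add: find_append)
  moreover from this have "leftmost p A = v" using assms(1) by (simp add: leftmost_def)
  ultimately show thesis using p by (intro that[of v us vs]) auto
qed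

text \<open>The rank is the position in \<open>p\<close>, which on \<open>A\<close> is smallest at
  the leftmost vertex.\<close>

lemma leftmost_acyclic_orientation:
  assumes p: "p \<in> permutations_of_set V"
  shows "leftmost p \<in> acyclic_orientations (V, B)"
proof -
  let ?r = "\<lambda>x. length (takeWhile (\<lambda>y. y \<noteq> x) p)"
  have "leftmost p A \<in> A \<and> (\<forall>x\<in>A. x \<noteq> leftmost p A \<longrightarrow> ?r (leftmost p A) < ?r x)"
    if A: "A \<in> B" for A
  proof -
    obtain us v vs where lm: "leftmost p A = v" and p': "p = us @ v # vs"
        and v: "set us \<inter> A = {}" "v \<in> A"
      using A p by (rule leftmost_split)
    have us: "y \<in> set us \<Longrightarrow> y \<noteq> x" if "x \<in> A" for x y using that v(1) by auto
    have "?r v = length us"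
      using us[OF v(2)] by (simp add: p' takeWhile_append2)
    \<comment> \<open>\<open>x\<close> lies in \<open>A\<close>, hence not in \<open>us\<close>, and
      differs from \<open>v\<close>, so its position is beyond that of \<open>v\<close>.\<close>
    moreover have "?r x > length us" if "x \<in> A" "x \<noteq> v" for x
      using us[OF that(1)] that(2) by (simp add: p' takeWhile_append2)
    ultimately show ?thesis using v(2) unfolding lm by auto
  qed
  then have "restrict (leftmost p) B \<in> acyclic_orientations (V, B)"
    by (rule ranked_acyclic_orientation)
  then show ?thesis by (simp add: leftmost_def)
qed

text \<open>If a vertex \<open>v\<close> other than \<open>h A\<close> came first in
  \<open>A\<close>, the arc from \<open>v\<close> to \<open>h A\<close> would run from left to right
  in \<open>p\<close>.\<close>

lemma leftmost_linear_extension: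
  assumes h: "h \<in> orientations (V, B)" and p: "p \<in> permutations_of_set V"
    and sorted: "sorted_wrt (\<lambda>y x. (y, x) \<notin> orientation_arcs (V, B) h) p"
  shows "leftmost p = h"
proof
  fix A
  show "leftmost p A = h A"
  proof (cases "A \<in> B")
    case True
    have hA: "h A \<in> A" using h True by (auto simp: orientations_def)
    obtain us v vs where lm: "leftmost p A = v" and p': "p = us @ v # vs"
        and v: "set us \<inter> A = {}" "v \<in> A"
      using True p by (rule leftmost_split)
    show ?thesis
    proof (rule ccontr)
      assume ne: "leftmost p A \<noteq> h A"
      have "h A \<in> set p" using hA B_subset[OF True] p by (auto dest: permutations_of_setD)
      then have "h A \<in> set vs" using hA v(1) ne lm by (auto simp: p')
      then have "(v, h A) \<notin> orientation_arcs (V, B) h"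
        using sorted by (auto simp: p' sorted_wrt_append)
      then show False using ne lm hA v(2) True by (auto simp: orientation_arcs_def)
    qed
  next
    case False
    then show ?thesis using h by (auto simp: leftmost_def orientations_def PiE_def extensional_def)
  qed
qed

section \<open>Pair flips and adjacent transpositions\<close>

lemma leftmost_transposition:
  assumes "us @ [a, b] @ vs \<in> permutations_of_set V"
  shows "leftmost (us @ [b, a] @ vs) =
    (\<lambda>A\<in>B. if leftmost (us @ [a, b] @ vs) A = a \<and> b \<in> A then b else leftmost (us @ [a, b] @ vs) A)"
proof -
  have ne: "a \<noteq> b" "a \<notin> set us"
    using assms by (auto simp: permutations_of_set_def)
  \<comment> \<open>An entry of \<open>us\<close> in \<open>A\<close> decides both searches alike.
    Otherwise the outcome changes only if \<open>a\<close> and \<open>b\<close> both lie in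
    \<open>A\<close>, which is the rule of a pair flip.\<close>
  have "the (find (\<lambda>v. v \<in> A) (us @ [b, a] @ vs)) =
      (let v = the (find (\<lambda>v. v \<in> A) (us @ [a, b] @ vs)) in if v = a \<and> b \<in> A then b else v)"
    for A
  proof (cases "find (\<lambda>v. v \<in> A) us")
    case (Some x)
    then have "x \<noteq> a" using find_SomeD ne(2) by fast
    then show ?thesis using Some by (simp add: find_append)
  next
    case None
    then show ?thesis
      using ne(1) by (cases "a \<in> A"; cases "b \<in> A") (simp_all add: find_append)
  qed
  then show ?thesis by (simp add: leftmost_def Let_def cong: restrict_cong if_cong)
qed

text \<open>A path from \<open>i\<close> through \<open>u\<close> to \<open>j\<close> would become a
  cycle for \<open>h'\<close>: arcs not ending in \<open>j\<close> survive, and the arc into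
  \<open>j\<close> is redirected to \<open>i\<close> or continued by the new arc
  \<open>(j, i)\<close>.\<close>

lemma acyclic_pair_flip_no_path:
  assumes h: "h \<in> acyclic_orientations (V, B)" and h': "h' \<in> acyclic_orientations (V, B)"
    and flip: "pair_flip (V, B) i j h h'"
  shows "(i, j) \<in> orientation_arcs (V, B) h"
    and "(i, u) \<in> (orientation_arcs (V, B) h)\<^sup>+ \<Longrightarrow> (u, j) \<in> (orientation_arcs (V, B) h)\<^sup>+ \<Longrightarrow> False"
proof -
  let ?R = "orientation_arcs (V, B) h" and ?R' = "orientation_arcs (V, B) h'"
  have ij: "i \<noteq> j" and h'_eq: "h' = (\<lambda>A\<in>B. if h A = j \<and> i \<in> A then i else h A)" and ne: "h' \<noteq> h"
    using flip by (auto simp: pair_flip_def)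
  have irr: "(x, x) \<notin> ?R\<^sup>+" "(x, x) \<notin> ?R'\<^sup>+" for x
    using h h' by (auto simp: acyclic_orientations_def acyclic_def)
  have h_ext: "h \<in> extensional B"
    using h by (auto simp: acyclic_orientations_def orientations_def PiE_def)
  \<comment> \<open>The flip changes \<open>h\<close>, and both maps are \<open>undefined\<close>
    outside \<open>B\<close>, so some hyperedge really changes its value.\<close>
  have "\<exists>A\<in>B. h A = j \<and> i \<in> A"
  proof (rule ccontr)
    assume "\<not> ?thesis"
    then have "h' = h" using h_ext unfolding h'_eq by (intro ext) (auto simp: extensional_def)
    then show False using ne by simp
  qed
  then obtain A where A: "A \<in> B" "h A = j" "i \<in> A" by blast
  have "j \<in> A" using acyclic_orientations_mem[OF h A(1)] A(2) by simp
  then show "(i, j) \<in> ?R" using A ij by (auto simp: orientation_arcs_def)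
  have ji: "(j, i) \<in> ?R'"
    using A ij \<open>j \<in> A\<close> unfolding orientation_arcs_def h'_eq by auto
  have keep: "(x, y) \<in> ?R'" if "(x, y) \<in> ?R" "y \<noteq> j" for x y
    using that unfolding orientation_arcs_def h'_eq by auto
  \<comment> \<open>The arc stems from a hyperedge \<open>A\<close>. If \<open>i\<close> is in
    \<open>A\<close>, its value moves to \<open>i\<close>; otherwise the arc persists and
    \<open>(j, i)\<close> extends it.\<close>
  have last: "x = i \<or> (x, i) \<in> ?R'\<^sup>+" if xj: "(x, j) \<in> ?R" for x
  proof -
    obtain A where A: "A \<in> B" "x \<in> A" "j \<in> A" "h A = j" "x \<noteq> j"
      using xj by (auto simp: orientation_arcs_def)
    show ?thesis
    proof (cases "i \<in> A")
      case True
      then have "x = i \<or> (x, i) \<in> ?R'" using A unfolding orientation_arcs_def h'_eq by auto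
      then show ?thesis by blast
    next
      case False
      then have "(x, j) \<in> ?R'" using A unfolding orientation_arcs_def h'_eq by auto
      with ji show ?thesis by (blast intro: trancl_into_trancl)
    qed
  qed
  \<comment> \<open>An inner vertex of the path still reaches \<open>j\<close>, so by acyclicity it
    is not \<open>j\<close> and the arc into it survives.\<close>
  have to_i: "x = i \<or> (x, i) \<in> ?R'\<^sup>+" if "(x, j) \<in> ?R\<^sup>+" for x
    using that
  proof (induction rule: converse_trancl_induct)
    case (base y)
    then show ?case by (rule last)
  next
    case (step y z)
    have "z \<noteq> j" using step(2) irr(1) by blast
    then have "(y, z) \<in> ?R'" using keep step(1) by blast
    then show ?case using step(3) by (blast intro: trancl_into_trancl2)
  qed
  \<comment> \<open>The premise that \<open>x\<close> reaches \<open>j\<close> is carried through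
    the induction: it keeps the path away from \<open>j\<close>.\<close>
  have from_i: "(i, x) \<in> ?R'\<^sup>+" if "(i, x) \<in> ?R\<^sup>+" "(x, j) \<in> ?R\<^sup>+" for x
    using that
  proof (induction rule: trancl_induct)
    case (base y)
    then show ?case using keep irr(1) by blast
  next
    case (step y z)
    have "z \<noteq> j" using step.prems irr(1) by blast
    then have "(y, z) \<in> ?R'" using keep step.hyps by blast
    moreover have "(y, j) \<in> ?R\<^sup>+" using step by (blast intro: trancl_into_trancl2)
    ultimately show ?case using step.IH by (blast intro: trancl_into_trancl)
  qed
  show False if "(i, u) \<in> ?R\<^sup>+" "(u, j) \<in> ?R\<^sup>+"
    using from_i[OF that] to_i[OF that(2)] irr(2) by (blast intro: trancl_trans)
qed

text \<open>A linear extension in which \<open>j\<close> stands immediately left of \<open>i\<close>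
  induces \<open>h\<close>; swapping the two induces \<open>h'\<close>, because a transposition of
  neighbours acts as a flip.\<close>

lemma pair_flip_imp_transposition:
  assumes h: "h \<in> acyclic_orientations (V, B)" and h': "h' \<in> acyclic_orientations (V, B)"
    and flip: "pair_flip (V, B) i j h h'"
  shows "\<exists>p\<in>permutations_of_set V. \<exists>q\<in>permutations_of_set V.
    adjacent_transposition p q \<and> h = leftmost p \<and> h' = leftmost q"
proof -
  have ij: "i \<in> V" "j \<in> V" and h'_eq: "h' = (\<lambda>A\<in>B. if h A = j \<and> i \<in> A then i else h A)"
    using flip by (auto simp: pair_flip_def)
  have hR: "h \<in> orientations (V, B)" "acyclic (orientation_arcs (V, B) h)"
    using h by (auto simp: acyclic_orientations_def)
  obtain us vs where *: "us @ [j, i] @ vs \<in> permutations_of_set V"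
      "sorted_wrt (\<lambda>y x. (y, x) \<notin> orientation_arcs (V, B) h) (us @ [j, i] @ vs)"
    using topological_sort_adjacent[OF finite_V hR(2) ij] acyclic_pair_flip_no_path[OF h h' flip]
    by blast
  have h_eq: "h = leftmost (us @ [j, i] @ vs)"
    using leftmost_linear_extension[OF hR(1) *] by simp
  moreover have "h' = leftmost (us @ [i, j] @ vs)"
    unfolding h'_eq leftmost_transposition[OF *(1)] h_eq ..
  moreover have "us @ [i, j] @ vs \<in> permutations_of_set V"
    using *(1) by (auto simp: permutations_of_set_def)
  moreover have "adjacent_transposition (us @ [j, i] @ vs) (us @ [i, j] @ vs)"
    by (auto simp: adjacent_transposition_def)
  ultimately show ?thesis using *(1) by blast
qed

lemma transposition_imp_pair_flip:
  assumes "p \<in> permutations_of_set V" "adjacent_transposition p q" "leftmost p \<noteq> leftmost q"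
  shows "\<exists>i j. pair_flip (V, B) i j (leftmost p) (leftmost q)"
proof -
  obtain us a b vs where p: "p = us @ [a, b] @ vs" and q: "q = us @ [b, a] @ vs"
    using assms(2) by (auto simp: adjacent_transposition_def)
  have "a \<in> V" "b \<in> V" "a \<noteq> b"
    using assms(1) by (auto simp: permutations_of_set_def p)
  \<comment> \<open>The value \<open>a\<close>, which came first, gives way to \<open>b\<close>;
    hence the flipped pair is \<open>(b, a)\<close>.\<close>
  then have "pair_flip (V, B) b a (leftmost p) (leftmost q)"
    using leftmost_transposition[of us a b vs] assms(1,3) by (auto simp: pair_flip_def p q)
  then show ?thesis by blast
qed

text \<open>Flips are made symmetric by the disjunction, whereas the right-hand side is symmetric
  because a transposition is its own inverse. The condition \<open>h \<noteq> h'\<close> is stated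
  since a transposition may leave the orientation unchanged.\<close>

lemma flip_iff_transposition:
  assumes "h \<in> acyclic_orientations (V, B)" "h' \<in> acyclic_orientations (V, B)"
  shows "(\<exists>i j. pair_flip (V, B) i j h h' \<or> pair_flip (V, B) i j h' h) \<longleftrightarrow>
    h \<noteq> h' \<and> (\<exists>p\<in>permutations_of_set V. \<exists>q\<in>permutations_of_set V.
      adjacent_transposition p q \<and> h = leftmost p \<and> h' = leftmost q)" (is "?L \<longleftrightarrow> ?R")
proof
  assume ?R
  then show ?L using transposition_imp_pair_flip by blast
next
  have sym: "adjacent_transposition q p" if "adjacent_transposition p q" for p q :: "'a list"
    using that unfolding adjacent_transposition_def by blast
  assume ?L
  then obtain i j where "pair_flip (V, B) i j h h' \<or> pair_flip (V, B) i j h' h" by blast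
  then show ?R
  proof
    assume flip: "pair_flip (V, B) i j h h'"
    then have "h \<noteq> h'" unfolding pair_flip_def by blast
    with pair_flip_imp_transposition[OF assms flip] show ?R by blast
  next
    assume flip: "pair_flip (V, B) i j h' h"
    then have "h \<noteq> h'" unfolding pair_flip_def by blast
    moreover obtain p q where "p \<in> permutations_of_set V" "q \<in> permutations_of_set V"
        "adjacent_transposition q p" "h = leftmost q" "h' = leftmost p"
      using pair_flip_imp_transposition[OF assms(2,1) flip] sym by blast
    ultimately show ?R by blast
  qed
qed

section \<open>The forest of an orientation\<close>

text \<open>For the connected vertex sets of a graph and a set \<open>S\<close> of its vertices,
  these are the vertex sets of the connected components of the subgraph induced by
  \<open>S\<close>.\<close>

definition components :: "'a set \<Rightarrow> 'a set set" where
  "components S = {C \<in> B. C \<subseteq> S \<and> \<not> (\<exists>D\<in>B. D \<subseteq> S \<and> C \<subset> D)}"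

lemma componentsD: "C \<in> components S \<Longrightarrow> C \<in> B" "C \<in> components S \<Longrightarrow> C \<subseteq> S"
  by (auto simp: components_def)

lemma finite_components [simp]: "finite (components S)"
proof (rule finite_subset)
  show "components S \<subseteq> Pow V" using componentsD(1) B_subset by blast
qed (simp add: finite_V)

lemma components_maximal: "C \<in> components S \<Longrightarrow> D \<in> B \<Longrightarrow> D \<subseteq> S \<Longrightarrow> C \<subseteq> D \<Longrightarrow> D = C"
  unfolding components_def by blast

text \<open>By closure under unions, \<open>C \<union> D\<close> is a member inside
  \<open>S\<close>, and maximality makes both components equal to it.\<close>

lemma components_disjoint:
  assumes C: "C \<in> components S" and D: "D \<in> components S" and x: "x \<in> C" "x \<in> D"
  shows "C = D"
proof -
  have "C \<inter> D \<noteq> {}" using x by blast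
  then have U: "C \<union> D \<in> B" by (rule B_union[OF componentsD(1)[OF C] componentsD(1)[OF D]])
  have US: "C \<union> D \<subseteq> S" by (rule Un_least[OF componentsD(2)[OF C] componentsD(2)[OF D]])
  have "C \<union> D = C" by (rule components_maximal[OF C U US]) (rule Un_upper1)
  moreover have "C \<union> D = D" by (rule components_maximal[OF D U US]) (rule Un_upper2)
  ultimately show ?thesis by simp
qed

lemma component_containing:
  assumes "A \<in> B" "A \<subseteq> S"
  obtains C where "C \<in> components S" "A \<subseteq> C"
proof -
  let ?X = "{C \<in> B. C \<subseteq> S}"
  have fin: "finite ?X"
    by (rule finite_subset[of _ "Pow V"]) (use B_subset in blast, simp add: finite_V)
  have "A \<in> ?X" using assms by simp
  from finite_has_maximal2[OF fin this]
  obtain C where C: "C \<in> ?X" "A \<subseteq> C" "\<forall>D\<in>?X. C \<subseteq> D \<longrightarrow> C = D"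
    by (elim bexE conjE)
  have "\<not> C \<subset> D" if "D \<in> B" "D \<subseteq> S" for D
    using bspec[OF C(3), of D] that by (simp add: psubset_eq)
  then have "C \<in> components S" using C(1) by (simp add: components_def)
  then show thesis using C(2) by (rule that)
qed

text \<open>Intersecting with \<open>V\<close> keeps the cardinalities finite for arbitrary
  \<open>S\<close>; the removed vertex \<open>v\<close> makes the inclusion strict.\<close>

lemma card_remove_component:
  assumes "C \<in> components S" "v \<in> C"
  shows "card ((C - {v}) \<inter> V) < card (S \<inter> V)"
proof (rule psubset_card_mono)
  have "v \<in> S \<inter> V" using componentsD[OF assms(1)] B_subset[of C] assms(2) by blast
  then show "(C - {v}) \<inter> V \<subset> S \<inter> V" using componentsD(2)[OF assms(1)] by blast
qed (simp add: finite_V)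

text \<open>Induction along the recursion of elimination forests, from the remains
  \<open>C - {v}\<close> of the components to \<open>S\<close>; the measure is
  \<open>card (S \<inter> V)\<close>.\<close>

lemma vertex_removal_induct:
  assumes step: "\<And>S. (\<And>C v. C \<in> components S \<Longrightarrow> v \<in> C \<Longrightarrow> P (C - {v})) \<Longrightarrow> P S"
  shows "P S"
proof (induction S rule: measure_induct_rule[of "\<lambda>S. card (S \<inter> V)"])
  case (less S)
  show ?case by (rule step, rule less, rule card_remove_component)
qed

text \<open>The guard \<open>h C \<in> C\<close> only serves termination; it holds for orientations.\<close>

function forest_of :: "('a set \<Rightarrow> 'a) \<Rightarrow> 'a set \<Rightarrow> 'a rtree fset" where
  "forest_of h S = Abs_fset ((\<lambda>C. Node (h C)
     (if h C \<in> C then forest_of h (C - {h C}) else {||})) ` components S)"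
  by auto
termination
proof (relation "measure (\<lambda>(h, S). card (S \<inter> V))", goal_cases)
  case (2 h S C)
  then show ?case
    using card_remove_component by (simp only: in_measure split)
qed simp

declare forest_of.simps [simp del]

text \<open>The recursion equation used from here on: \<open>h C \<in> C\<close> discharges the
  guard, and finiteness of \<open>components S\<close> the abstraction
  \<open>Abs_fset\<close>.\<close>

lemma fset_forest_of:
  assumes "\<And>A. A \<in> B \<Longrightarrow> A \<subseteq> S \<Longrightarrow> h A \<in> A"
  shows "fset (forest_of h S) = (\<lambda>C. Node (h C) (forest_of h (C - {h C}))) ` components S"
proof -
  have "fset (forest_of h S) = (\<lambda>C. Node (h C)
     (if h C \<in> C then forest_of h (C - {h C}) else {||})) ` components S"
    by (subst forest_of.simps) (simp add: Abs_fset_inverse)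
  also have "\<dots> = (\<lambda>C. Node (h C) (forest_of h (C - {h C}))) ` components S"
    using assms by (intro image_cong) (auto dest: componentsD)
  finally show ?thesis .
qed

text \<open>The recursion evaluates \<open>h\<close> only on components, which are members of
  \<open>B\<close> inside \<open>S\<close>.\<close>

lemma forest_of_cong:
  assumes "\<And>A. A \<in> B \<Longrightarrow> A \<subseteq> S \<Longrightarrow> h A = h' A"
  shows "forest_of h S = forest_of h' S"
  using assms
proof (induction S rule: vertex_removal_induct)
  case (1 S)
  have eq: "h C = h' C" if "C \<in> components S" for C
    using 1(2) componentsD[OF that] by blast
  moreover have "forest_of h (C - {h' C}) = forest_of h' (C - {h' C})"
    if "C \<in> components S" "h' C \<in> C" for C
    using componentsD[OF that(1)] by (intro 1(1) that 1(2)) auto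
  ultimately show ?case
    unfolding forest_of.simps[of _ S] by (intro arg_cong[of _ _ Abs_fset] image_cong) auto
qed

text \<open>Let \<open>C\<close> be the component containing \<open>A\<close>; its root identifies
  the tree of \<open>C\<close> in both forests. If the root lies in \<open>A\<close>, heredity gives
  the value on \<open>A\<close>; otherwise \<open>A\<close> survives the removal of the root and the
  induction hypothesis applies to the subforests.\<close>

lemma forest_of_determines:
  assumes h: "h \<in> acyclic_orientations (V, B)" and h': "h' \<in> acyclic_orientations (V, B)"
    and "forest_of h S = forest_of h' S" "A \<in> B" "A \<subseteq> S"
  shows "h A = h' A"
  using assms(3-5)
proof (induction S rule: vertex_removal_induct)
  case (1 S)
  obtain C where C: "C \<in> components S" "A \<subseteq> C"
    using component_containing[OF 1(3,4)] .
  have C_B: "C \<in> B" using componentsD[OF C(1)] by blast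
  note mem = acyclic_orientations_mem[OF h] acyclic_orientations_mem[OF h']
  have "Node (h C) (forest_of h (C - {h C})) \<in> fset (forest_of h S)"
    using C(1) mem by (subst fset_forest_of) auto
  also have "\<dots> = (\<lambda>C. Node (h' C) (forest_of h' (C - {h' C}))) ` components S"
    unfolding 1(2) using mem by (intro fset_forest_of) auto
  finally obtain D where D: "D \<in> components S" "h C = h' D"
      "forest_of h (C - {h C}) = forest_of h' (D - {h' D})"
    by auto
  \<comment> \<open>The common root \<open>h C = h' D\<close> lies in both components, which are
    therefore equal.\<close>
  have "D = C"
    using components_disjoint[OF D(1) C(1), of "h C"] mem(1)[OF C_B] mem(2)[of D] D componentsD[OF D(1)]
    by auto
  show ?case
  proof (cases "h C \<in> A")
    case True
    then show ?thesis
      using acyclic_orientation_hereditary[OF h 1(3) C_B C(2)]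
        acyclic_orientation_hereditary[OF h' 1(3) C_B C(2)] D(2) \<open>D = C\<close> by simp
  next
    case False
    then show ?thesis
      using 1(1)[OF C(1) mem(1)[OF C_B] _ 1(3)] C(2) D \<open>D = C\<close> by auto
  qed
qed

lemma forest_of_inj_on: "inj_on (\<lambda>h. forest_of h V) (acyclic_orientations (V, B))"
proof (rule inj_onI)
  fix h h' assume hh': "h \<in> acyclic_orientations (V, B)" "h' \<in> acyclic_orientations (V, B)"
    "forest_of h V = forest_of h' V"
  then have "h \<in> extensional B" "h' \<in> extensional B"
    by (auto simp: acyclic_orientations_def orientations_def PiE_def)
  then show "h = h'"
    by (rule extensionalityI) (use forest_of_determines[OF hh'] B_subset in blast)
qed

section \<open>Ranks and gluing of orientations along components\<close>

definition ranked :: "('a set \<Rightarrow> 'a) \<Rightarrow> ('a \<Rightarrow> nat) \<Rightarrow> 'a set \<Rightarrow> bool" where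
  "ranked h r S \<longleftrightarrow>
     (\<forall>A\<in>B. A \<subseteq> S \<longrightarrow> h A \<in> A \<and> (\<forall>x\<in>A. x \<noteq> h A \<longrightarrow> r (h A) < r x))"

text \<open>The induction step of surjectivity: the solutions \<open>g C\<close> with ranks
  \<open>s C\<close> below the roots \<open>v C\<close> are merged. If \<open>s C\<close> is the
  depth below \<open>v C\<close>, then \<open>r\<close> is the depth in the whole forest.\<close>

lemma ranked_glue:
  assumes v: "\<And>C. C \<in> components S \<Longrightarrow> v C \<in> C"
    and IH: "\<And>C. C \<in> components S \<Longrightarrow> ranked (g C) (s C) (C - {v C}) \<and> f C = forest_of (g C) (C - {v C})"
    and F: "fset F = (\<lambda>C. Node (v C) (f C)) ` components S"
  shows "\<exists>h r. ranked h r S \<and> F = forest_of h S"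
proof -
  \<comment> \<open>\<open>K\<close> and \<open>L\<close> send a vertex, or a member of
    \<open>B\<close>, to the component containing it; disjointness gives uniqueness, for
    \<open>L\<close> through an element of the nonempty member.\<close>
  define K where "K x = (THE C. C \<in> components S \<and> x \<in> C)" for x
  have K: "K x = C" if "C \<in> components S" "x \<in> C" for x C
    unfolding K_def
  proof (rule the_equality)
    show "C \<in> components S \<and> x \<in> C" using that ..
    show "D = C" if "D \<in> components S \<and> x \<in> D" for D
      using components_disjoint[of D S C x] that \<open>C \<in> components S\<close> \<open>x \<in> C\<close> by simp
  qed
  define L where "L A = (THE C. C \<in> components S \<and> A \<subseteq> C)" for A
  have L: "L A = C" if "C \<in> components S" "A \<in> B" "A \<subseteq> C" for A C
    unfolding L_def
  proof (rule the_equality)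
    show "C \<in> components S \<and> A \<subseteq> C" using that by simp
    obtain x where "x \<in> A" using B_nonempty[OF \<open>A \<in> B\<close>] by (meson ex_in_conv)
    then show "D = C" if "D \<in> components S \<and> A \<subseteq> D" for D
      using components_disjoint[of D S C x] that \<open>C \<in> components S\<close> \<open>A \<subseteq> C\<close> by (simp add: subset_iff)
  qed
  \<comment> \<open>A member containing the root selects it; any other one inside \<open>C\<close>
    lies in \<open>C - {v C}\<close>, where \<open>g C\<close> decides.\<close>
  define h where "h A = (if v (L A) \<in> A then v (L A) else g (L A) A)" for A
  \<comment> \<open>Rank 0 is reserved for the roots, and \<open>Suc\<close> puts the other vertices
    of a component above its root.\<close>
  define r where "r x = (if x = v (K x) then 0 else Suc (s (K x) x))" for x
  have r_h: "h A \<in> A \<and> (\<forall>x\<in>A. x \<noteq> h A \<longrightarrow> r (h A) < r x)" if A: "A \<in> B" "A \<subseteq> S" for A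
  proof -
    obtain C where C: "C \<in> components S" "A \<subseteq> C" using component_containing[OF A] .
    have LA: "L A = C" by (rule L[OF C(1) A(1) C(2)])
    have KA: "K x = C" if "x \<in> A" for x by (rule K[OF C(1) subsetD[OF C(2) that]])
    show ?thesis
    proof (cases "v C \<in> A")
      case True
      then show ?thesis using KA LA by (simp add: h_def r_def)
    next
      case False
      then have "A \<subseteq> C - {v C}" using C by blast
      then have g: "g C A \<in> A" "\<forall>x\<in>A. x \<noteq> g C A \<longrightarrow> s C (g C A) < s C x"
        using IH[OF C(1)] A(1) by (simp_all add: ranked_def)
      have hA: "h A = g C A" using LA False by (simp add: h_def)
      have r: "r x = Suc (s C x)" if "x \<in> A" for x
        using KA[OF that] False that by (auto simp: r_def)
      show ?thesis unfolding hA using g r by simp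
    qed
  qed
  then have "ranked h r S" by (simp add: ranked_def)
  moreover have "Node (v C) (f C) = Node (h C) (forest_of h (C - {h C}))"
    if C: "C \<in> components S" for C
  proof -
    have "L C = C" by (rule L[OF C componentsD(1)[OF C] order_refl])
    then have hC: "h C = v C" using v[OF C] by (simp add: h_def)
    \<comment> \<open>Members inside \<open>C - {v C}\<close> avoid the root, so \<open>h\<close>
      and \<open>g C\<close> agree on them.\<close>
    have "forest_of (g C) (C - {v C}) = forest_of h (C - {v C})"
    proof (rule forest_of_cong)
      fix A assume A: "A \<in> B" "A \<subseteq> C - {v C}"
      then have "A \<subseteq> C" "v C \<notin> A" by (simp_all add: subset_Diff_insert)
      then show "g C A = h A" using L[OF C A(1)] by (simp add: h_def)
    qed
    then show ?thesis using hC IH[OF C] by simp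
  qed
  then have "fset F = fset (forest_of h S)"
    unfolding F using r_h by (subst fset_forest_of) (simp_all cong: image_cong)
  then have "F = forest_of h S" by (simp add: fset_inject)
  ultimately show ?thesis by (intro exI conjI)
qed

end

section \<open>Elimination forests of graphs\<close>

context graph
begin

section \<open>Connectivity in induced subgraphs\<close>

lemma induce_subgraph_verts_self [simp]: "G \<restriction> verts G = G"
  by (intro pre_digraph.equality) auto

lemma del_vert_induce_subgraph: "pre_digraph.del_vert (G \<restriction> C) v = G \<restriction> (C - {v})"
  by (intro pre_digraph.equality) (auto simp: pre_digraph.del_vert_def)

lemma subgraph_induce_mono: "A \<subseteq> S \<Longrightarrow> subgraph (G \<restriction> A) (G \<restriction> S)"
  by (intro subgraphI wellformed_induce_subgraph) (auto simp: compatible_def)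

text \<open>\<open>G\<close> is symmetric, so both notions agree. This links the building set,
  defined with \<open>connected\<close>, to \<open>sccs\<close>, defined with strong
  connectivity.\<close>

lemma connected_induce_subgraph_iff:
  assumes "U \<subseteq> verts G"
  shows "connected (G \<restriction> U) \<longleftrightarrow> strongly_connected (G \<restriction> U)"
proof -
  interpret U: wf_digraph "G \<restriction> U" by (rule wellformed_induce_subgraph)
  have "symmetric (G \<restriction> U)"
    using induced_graph_imp_symmetric[OF sym_arcs induced_induce[OF assms]] .
  moreover have "connected (G \<restriction> U)" if "strongly_connected (G \<restriction> U)"
    using that U.reachable_mk_symmetricI
    by (intro U.connectedI) (auto simp: strongly_connected_def)
  ultimately show ?thesis
    using U.symmetric_connected_imp_strongly_connected by blast
qed

text \<open>Every vertex is joined to \<open>w\<close> in both directions inside \<open>A\<close> or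
  inside \<open>C\<close>, and paths compose at \<open>w\<close>.\<close>

lemma strongly_connected_induce_union:
  assumes "strongly_connected (G \<restriction> A)" "strongly_connected (G \<restriction> C)" "w \<in> A" "w \<in> C"
  shows "strongly_connected (G \<restriction> (A \<union> C))"
proof -
  interpret AC: wf_digraph "G \<restriction> (A \<union> C)" by (rule wellformed_induce_subgraph)
  have "x \<rightarrow>\<^sup>*\<^bsub>G \<restriction> (A \<union> C)\<^esub> w \<and> w \<rightarrow>\<^sup>*\<^bsub>G \<restriction> (A \<union> C)\<^esub> x" if x: "x \<in> A \<union> C" for x
  proof -
    \<comment> \<open>\<open>D\<close> is \<open>A\<close> or \<open>C\<close>, whichever contains
      \<open>x\<close>.\<close>
    obtain D where D: "D \<subseteq> A \<union> C" "strongly_connected (G \<restriction> D)" "x \<in> D" "w \<in> D"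
      using x assms that[of A] that[of C] by (simp only: Un_iff Un_upper1 Un_upper2) metis
    then have "x \<rightarrow>\<^sup>*\<^bsub>G \<restriction> D\<^esub> w" "w \<rightarrow>\<^sup>*\<^bsub>G \<restriction> D\<^esub> x"
      by (simp_all add: strongly_connected_def)
    then show ?thesis
      using AC.reachable_mono[OF _ subgraph_induce_mono[OF D(1)]] by simp
  qed
  then show ?thesis
    using assms(3) AC.reachable_trans unfolding strongly_connected_def induce_subgraph_verts
    by (metis UnI1 empty_iff)
qed

definition connected_sets :: "'a set set" where
  "connected_sets = {U. U \<subseteq> verts G \<and> U \<noteq> {} \<and> connected (G \<restriction> U)}"

lemma graphical_building_set_eq: "graphical_building_set G = (verts G, connected_sets)"
  by (simp add: graphical_building_set_def connected_sets_def)

text \<open>Nonemptiness is absorbed, being part of strong connectivity.\<close>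

lemma connected_sets_iff: "U \<in> connected_sets \<longleftrightarrow> U \<subseteq> verts G \<and> strongly_connected (G \<restriction> U)"
  using connected_induce_subgraph_iff by (auto simp: connected_sets_def strongly_connected_def)

sublocale BS: building_set "verts G" connected_sets
proof
  fix A C assume "A \<in> connected_sets" "C \<in> connected_sets" "A \<inter> C \<noteq> {}"
  then show "A \<union> C \<in> connected_sets"
    using strongly_connected_induce_union[of A C] by (auto simp: connected_sets_iff)
qed (auto simp: connected_sets_def)

text \<open>\<open>tail\<close> and \<open>head\<close> are inherited and the arcs are those with
  both ends among the vertices, so an induced subgraph is determined by its vertex set.\<close>

lemma induced_subgraph_induce_iff:
  assumes "S \<subseteq> verts G"
  shows "induced_subgraph H (G \<restriction> S) \<longleftrightarrow> (\<exists>C\<subseteq>S. H = G \<restriction> C)"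
proof
  assume H: "induced_subgraph H (G \<restriction> S)"
  then have sub: "verts H \<subseteq> S" "tail H = tail G" "head H = head G"
    by (simp_all add: induced_subgraph_def subgraph_def compatible_def)
  moreover have "arcs H = arcs (G \<restriction> verts H)"
    using H sub by (auto simp add: induced_subgraph_def)
  ultimately have "H = G \<restriction> verts H" by simp
  with sub(1) show "\<exists>C\<subseteq>S. H = G \<restriction> C" by metis
next
  assume "\<exists>C\<subseteq>S. H = G \<restriction> C"
  then obtain C where C: "C \<subseteq> S" "H = G \<restriction> C" by (elim exE conjE)
  moreover have "arcs (G \<restriction> C) = {e \<in> arcs (G \<restriction> S). tail G e \<in> C \<and> head G e \<in> C}"
    using C(1) by (auto simp: subset_iff)
  ultimately show "induced_subgraph H (G \<restriction> S)"
    using subgraph_induce_mono[OF C(1)] unfolding induced_subgraph_def by simp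
qed

text \<open>Induced subgraphs correspond to vertex sets, so maximality among strongly connected
  induced subgraphs becomes maximality among connected sets inside \<open>S\<close>.\<close>

lemma sccs_induce_subgraph:
  assumes "S \<subseteq> verts G"
  shows "pre_digraph.sccs (G \<restriction> S) = (\<lambda>C. G \<restriction> C) ` BS.components S"
proof -
  have comp: "C \<in> BS.components S \<longleftrightarrow> C \<subseteq> S \<and> strongly_connected (G \<restriction> C) \<and>
      \<not> (\<exists>D\<subseteq>S. strongly_connected (G \<restriction> D) \<and> C \<subset> D)" for C
  proof -
    have "D \<in> connected_sets \<and> D \<subseteq> S \<longleftrightarrow> D \<subseteq> S \<and> strongly_connected (G \<restriction> D)" for D
      using assms unfolding connected_sets_iff by (metis subset_trans)
    then show ?thesis unfolding BS.components_def mem_Collect_eq by metis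
  qed
  have sccs_iff: "H \<in> pre_digraph.sccs (G \<restriction> S) \<longleftrightarrow> induced_subgraph H (G \<restriction> S) \<and>
      strongly_connected H \<and> (\<forall>H'. induced_subgraph H' (G \<restriction> S) \<longrightarrow> strongly_connected H' \<longrightarrow>
        \<not> verts H \<subset> verts H')" for H
    unfolding pre_digraph.sccs_def mem_Collect_eq by metis
  have sccs: "H \<in> pre_digraph.sccs (G \<restriction> S) \<longleftrightarrow> (\<exists>C. H = G \<restriction> C \<and> C \<in> BS.components S)" for H
  proof
    assume H: "H \<in> pre_digraph.sccs (G \<restriction> S)"
    then have "induced_subgraph H (G \<restriction> S)" by (simp only: sccs_iff)
    then obtain C where C: "C \<subseteq> S" "H = G \<restriction> C"
      unfolding induced_subgraph_induce_iff[OF assms] by (elim exE conjE)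
    have "\<not> C \<subset> D" if "D \<subseteq> S" "strongly_connected (G \<restriction> D)" for D
    proof -
      have "induced_subgraph (G \<restriction> D) (G \<restriction> S)"
        unfolding induced_subgraph_induce_iff[OF assms] using that(1) by metis
      then show ?thesis
        using H that(2) unfolding sccs_iff C(2) induce_subgraph_verts by (metis induce_subgraph_verts)
    qed
    moreover have "strongly_connected (G \<restriction> C)" using H C(2) by (simp only: sccs_iff)
    ultimately have "C \<in> BS.components S" using C(1) unfolding comp by simp
    with C(2) show "\<exists>C. H = G \<restriction> C \<and> C \<in> BS.components S" by (intro exI conjI)
  next
    assume "\<exists>C. H = G \<restriction> C \<and> C \<in> BS.components S"
    then obtain C where C: "H = G \<restriction> C" "C \<in> BS.components S" by (elim exE conjE)
    have "\<not> C \<subset> verts H'" if H': "induced_subgraph H' (G \<restriction> S)" "strongly_connected H'" for H'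
    proof -
      obtain D where "D \<subseteq> S" "H' = G \<restriction> D"
        using H'(1) unfolding induced_subgraph_induce_iff[OF assms] by (elim exE conjE)
      then show ?thesis using C(2) H'(2) unfolding comp by simp
    qed
    moreover have "induced_subgraph H (G \<restriction> S)"
      unfolding induced_subgraph_induce_iff[OF assms] using C unfolding comp by metis
    ultimately show "H \<in> pre_digraph.sccs (G \<restriction> S)"
      using C(2) unfolding sccs_iff C(1) induce_subgraph_verts comp by simp
  qed
  show ?thesis
  proof (rule set_eqI)
    show "H \<in> pre_digraph.sccs (G \<restriction> S) \<longleftrightarrow> H \<in> (\<restriction>) G ` BS.components S" for H
      unfolding sccs image_iff by metis
  qed
qed

section \<open>Recursion equations for forests over vertex sets\<close>

lemma componentD:
  assumes "C \<in> BS.components S"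
  shows "connected (G \<restriction> C)" "C \<subseteq> verts G"
  using BS.componentsD[OF assms] by (auto simp: connected_sets_def)

text \<open>Merges the rules for trees and forests into one recursion over vertex sets, suited to
  \<open>BS.vertex_removal_induct\<close>; \<open>v\<close> and \<open>f\<close> choose the root and
  the subforest of each component.\<close>

lemma elimination_forest_unfold:
  assumes "S \<subseteq> verts G"
  shows "elimination_forest (G \<restriction> S) F \<longleftrightarrow> (\<exists>v f.
    (\<forall>C\<in>BS.components S. v C \<in> C \<and> elimination_forest (G \<restriction> (C - {v C})) (f C)) \<and>
    fset F = (\<lambda>C. Node (v C) (f C)) ` BS.components S)" (is "?L \<longleftrightarrow> ?R")
proof
  assume ?L
  then obtain t where t: "\<forall>C\<in>BS.components S. elimination_tree (G \<restriction> C) (t (G \<restriction> C))"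
      "fset F = (\<lambda>C. t (G \<restriction> C)) ` BS.components S"
    by (cases rule: elimination_forest.cases) (simp add: sccs_induce_subgraph[OF assms] image_image)
  have "\<forall>C\<in>BS.components S. \<exists>v f. t (G \<restriction> C) = Node v f \<and>
      v \<in> C \<and> elimination_forest (G \<restriction> (C - {v})) f"
  proof
    fix C assume "C \<in> BS.components S"
    then have "elimination_tree (G \<restriction> C) (t (G \<restriction> C))" using t(1) by simp
    then show "\<exists>v f. t (G \<restriction> C) = Node v f \<and> v \<in> C \<and> elimination_forest (G \<restriction> (C - {v})) f"
      by (cases rule: elimination_tree.cases) (simp add: del_vert_induce_subgraph)
  qed
  then obtain v f where "\<forall>C\<in>BS.components S. t (G \<restriction> C) = Node (v C) (f C) \<and>
      v C \<in> C \<and> elimination_forest (G \<restriction> (C - {v C})) (f C)"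
    by metis
  moreover from this have "fset F = (\<lambda>C. Node (v C) (f C)) ` BS.components S"
    unfolding t(2) by (intro image_cong) simp_all
  ultimately show ?R by (intro exI[of _ v] exI[of _ f]) simp
next
  assume ?R
  then obtain v f where
    *: "\<forall>C\<in>BS.components S. v C \<in> C \<and> elimination_forest (G \<restriction> (C - {v C})) (f C)"
      "fset F = (\<lambda>C. Node (v C) (f C)) ` BS.components S" by (elim exE conjE)
  \<comment> \<open>The rule \<open>forest\<close> expects a function of digraphs; the component is
    recovered as the vertex set.\<close>
  define t where "t H = Node (v (verts H)) (f (verts H))" for H :: "('a, 'b) pre_digraph"
  have "\<forall>C\<in>BS.components S. elimination_tree (G \<restriction> C) (t (G \<restriction> C))"
    unfolding t_def induce_subgraph_verts using *(1)
    by (intro ballI elimination_tree_elimination_forest.tree)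
      (simp_all add: componentD del_vert_induce_subgraph)
  then show ?L
    by (intro elimination_tree_elimination_forest.forest[of _ t])
      (simp_all add: sccs_induce_subgraph[OF assms] *(2) t_def image_image)
qed

text \<open>Here \<open>p\<close> forces the roots, so only the subforests are existentially
  quantified.\<close>

lemma permutation_forest_unfold:
  assumes "S \<subseteq> verts G" and p: "p \<in> permutations_of_set (verts G)"
  shows "permutation_forest p (G \<restriction> S) F \<longleftrightarrow> (\<exists>f.
    (\<forall>C\<in>BS.components S. permutation_forest p (G \<restriction> (C - {BS.leftmost p C})) (f C)) \<and>
    fset F = (\<lambda>C. Node (BS.leftmost p C) (f C)) ` BS.components S)" (is "?L \<longleftrightarrow> ?R")
proof -
  \<comment> \<open>The vertex set of \<open>G \<restriction> C\<close> is \<open>C\<close>, so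
    \<open>find\<close> yields the value of the leftmost orientation.\<close>
  have find: "find (\<lambda>v. v \<in> C) p = Some (BS.leftmost p C)" if C: "C \<in> BS.components S" for C
    using BS.componentsD(1)[OF C] p by (rule BS.leftmost_split) simp
  show ?thesis
  proof
    assume ?L
    then obtain t where t: "\<forall>C\<in>BS.components S. permutation_tree p (G \<restriction> C) (t (G \<restriction> C))"
        "fset F = (\<lambda>C. t (G \<restriction> C)) ` BS.components S"
      by (cases rule: permutation_forest.cases) (simp add: sccs_induce_subgraph[OF assms(1)] image_image)
    have "\<forall>C\<in>BS.components S. \<exists>f. t (G \<restriction> C) = Node (BS.leftmost p C) f \<and>
        permutation_forest p (G \<restriction> (C - {BS.leftmost p C})) f"
    proof
      fix C assume C: "C \<in> BS.components S"
      then have "permutation_tree p (G \<restriction> C) (t (G \<restriction> C))" using t(1) by simp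
      then show "\<exists>f. t (G \<restriction> C) = Node (BS.leftmost p C) f \<and>
          permutation_forest p (G \<restriction> (C - {BS.leftmost p C})) f"
        by (cases rule: permutation_tree.cases) (simp add: del_vert_induce_subgraph find[OF C])
    qed
    then obtain f where "\<forall>C\<in>BS.components S. t (G \<restriction> C) = Node (BS.leftmost p C) (f C) \<and>
        permutation_forest p (G \<restriction> (C - {BS.leftmost p C})) (f C)"
      by metis
    moreover from this have "fset F = (\<lambda>C. Node (BS.leftmost p C) (f C)) ` BS.components S"
      unfolding t(2) by (intro image_cong) simp_all
    ultimately show ?R by (intro exI[of _ f]) simp
  next
    assume ?R
    then obtain f where
      *: "\<forall>C\<in>BS.components S. permutation_forest p (G \<restriction> (C - {BS.leftmost p C})) (f C)"
        "fset F = (\<lambda>C. Node (BS.leftmost p C) (f C)) ` BS.components S" by (elim exE conjE)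
    define t where "t H = Node (BS.leftmost p (verts H)) (f (verts H))" for H :: "('a, 'b) pre_digraph"
    have "\<forall>C\<in>BS.components S. permutation_tree p (G \<restriction> C) (t (G \<restriction> C))"
      unfolding t_def induce_subgraph_verts using *(1)
      by (intro ballI permutation_tree_permutation_forest.tree)
        (simp_all add: componentD del_vert_induce_subgraph find)
    then show ?L
      by (intro permutation_tree_permutation_forest.forest[of _ _ t])
        (simp_all add: sccs_induce_subgraph[OF assms(1)] *(2) t_def image_image)
  qed
qed

text \<open>The roots \<open>h C\<close> with the recursively defined subforests are admissible
  choices in \<open>elimination_forest_unfold\<close>.\<close>

lemma elimination_forest_of:
  assumes "S \<subseteq> verts G" "\<And>A. A \<in> connected_sets \<Longrightarrow> A \<subseteq> S \<Longrightarrow> h A \<in> A"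
  shows "elimination_forest (G \<restriction> S) (BS.forest_of h S)"
  using assms
proof (induction S rule: BS.vertex_removal_induct)
  case (1 S)
  have "h C \<in> C \<and> elimination_forest (G \<restriction> (C - {h C})) (BS.forest_of h (C - {h C}))"
    if C: "C \<in> BS.components S" for C
  proof -
    note CD = BS.componentsD[OF C] componentD[OF C]
    have hC: "h C \<in> C" by (rule 1(3)[OF CD(1,2)])
    moreover have "elimination_forest (G \<restriction> (C - {h C})) (BS.forest_of h (C - {h C}))"
    proof (rule 1(1)[OF C hC])
      show "C - {h C} \<subseteq> verts G" using CD(4) by (simp add: subset_iff)
      show "h A \<in> A" if "A \<in> connected_sets" "A \<subseteq> C - {h C}" for A
        using that CD(2) by (intro 1(3)) (simp_all add: subset_iff)
    qed
    ultimately show ?thesis ..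
  qed
  moreover have "fset (BS.forest_of h S) =
      (\<lambda>C. Node (h C) (BS.forest_of h (C - {h C}))) ` BS.components S"
    by (intro BS.fset_forest_of 1(3))
  ultimately show ?case
    unfolding elimination_forest_unfold[OF 1(2)]
    by (intro exI[of _ h] exI[of _ "\<lambda>C. BS.forest_of h (C - {h C})"]) simp
qed

text \<open>Surjectivity in local form: every component contributes an orientation and ranks for its
  subforest, and \<open>BS.ranked_glue\<close> merges them.\<close>

lemma elimination_forest_ranked:
  assumes "S \<subseteq> verts G" "elimination_forest (G \<restriction> S) F"
  shows "\<exists>h r. BS.ranked h r S \<and> F = BS.forest_of h S"
  using assms
proof (induction S arbitrary: F rule: BS.vertex_removal_induct)
  case (1 S)
  obtain v f where vf: "\<forall>C\<in>BS.components S. v C \<in> C \<and> elimination_forest (G \<restriction> (C - {v C})) (f C)"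
      and F: "fset F = (\<lambda>C. Node (v C) (f C)) ` BS.components S"
    using 1(3) unfolding elimination_forest_unfold[OF 1(2)] by (elim exE conjE)
  have v: "v C \<in> C" and f: "elimination_forest (G \<restriction> (C - {v C})) (f C)"
    if "C \<in> BS.components S" for C
    using vf that by simp_all
  have "\<exists>g s. BS.ranked g s (C - {v C}) \<and> f C = BS.forest_of g (C - {v C})"
    if C: "C \<in> BS.components S" for C
    using componentD(2)[OF C] by (intro 1(1)[OF C v[OF C] _ f[OF C]]) (simp add: subset_iff)
  then obtain g s where "\<And>C. C \<in> BS.components S \<Longrightarrow>
      BS.ranked (g C) (s C) (C - {v C}) \<and> f C = BS.forest_of (g C) (C - {v C})"
    by metis
  from BS.ranked_glue[OF v this F] show ?case .
qed

text \<open>Both sides obey the same recursion with roots \<open>BS.leftmost p C\<close>. In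
  particular, \<open>p\<close> produces exactly one forest.\<close>

lemma permutation_forest_iff:
  assumes "S \<subseteq> verts G" "p \<in> permutations_of_set (verts G)"
  shows "permutation_forest p (G \<restriction> S) F \<longleftrightarrow> F = BS.forest_of (BS.leftmost p) S"
  using assms(1)
proof (induction S arbitrary: F rule: BS.vertex_removal_induct)
  case (1 S)
  let ?h = "BS.leftmost p"
  have mem: "?h A \<in> A" if A: "A \<in> connected_sets" for A
    using BS.acyclic_orientations_mem[OF BS.leftmost_acyclic_orientation[OF assms(2)] A] .
  have IH: "permutation_forest p (G \<restriction> (C - {?h C})) F \<longleftrightarrow> F = BS.forest_of ?h (C - {?h C})"
    if C: "C \<in> BS.components S" for C F
    using componentD(2)[OF C]
    by (intro 1(1)[OF C mem[OF BS.componentsD(1)[OF C]]]) (simp add: subset_iff)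
  have "permutation_forest p (G \<restriction> S) F \<longleftrightarrow> (\<exists>f.
      (\<forall>C\<in>BS.components S. f C = BS.forest_of ?h (C - {?h C})) \<and>
      fset F = (\<lambda>C. Node (?h C) (f C)) ` BS.components S)"
    unfolding permutation_forest_unfold[OF 1(2) assms(2)] using IH by simp
  also have "\<dots> \<longleftrightarrow>
      fset F = (\<lambda>C. Node (?h C) (BS.forest_of ?h (C - {?h C}))) ` BS.components S"
  proof (intro iffI; (elim exE conjE)?)
    fix f assume "\<forall>C\<in>BS.components S. f C = BS.forest_of ?h (C - {?h C})"
      and F: "fset F = (\<lambda>C. Node (?h C) (f C)) ` BS.components S"
    then show "fset F = (\<lambda>C. Node (?h C) (BS.forest_of ?h (C - {?h C}))) ` BS.components S"
      unfolding F by (intro image_cong) simp_all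
  next
    assume "fset F = (\<lambda>C. Node (?h C) (BS.forest_of ?h (C - {?h C}))) ` BS.components S"
    then show "\<exists>f. (\<forall>C\<in>BS.components S. f C = BS.forest_of ?h (C - {?h C})) \<and>
        fset F = (\<lambda>C. Node (?h C) (f C)) ` BS.components S"
      by (intro exI[of _ "\<lambda>C. BS.forest_of ?h (C - {?h C})"]) simp
  qed
  also have "\<dots> \<longleftrightarrow> fset F = fset (BS.forest_of ?h S)"
    using mem by (subst BS.fset_forest_of) simp_all
  finally show ?case by (simp add: fset_inject)
qed

section \<open>The bijection and the correspondence of flips and rotations\<close>

lemma forest_of_bij_betw:
  "bij_betw (\<lambda>h. BS.forest_of h (verts G)) (acyclic_orientations (graphical_building_set G))
    {F. elimination_forest G F}"
  unfolding graphical_building_set_eq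
proof (rule bij_betw_imageI[OF BS.forest_of_inj_on], intro equalityI subsetI)
  fix F assume "F \<in> (\<lambda>h. BS.forest_of h (verts G)) ` acyclic_orientations (verts G, connected_sets)"
  then show "F \<in> {F. elimination_forest G F}"
    using elimination_forest_of[of "verts G"] BS.acyclic_orientations_mem by auto
next
  fix F assume "F \<in> {F. elimination_forest G F}"
  then obtain h r where h: "BS.ranked h r (verts G)" "F = BS.forest_of h (verts G)"
    using elimination_forest_ranked[of "verts G" F] by auto
  \<comment> \<open>Outside the connected sets \<open>h\<close> is arbitrary; the restriction makes
    it an orientation and leaves the forest unchanged.\<close>
  have "restrict h connected_sets \<in> acyclic_orientations (verts G, connected_sets)"
    using h(1) BS.B_subset by (intro BS.ranked_acyclic_orientation[of h r]) (auto simp: BS.ranked_def)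
  moreover have "F = BS.forest_of (restrict h connected_sets) (verts G)"
    unfolding h(2) by (rule BS.forest_of_cong) simp
  ultimately show "F \<in> (\<lambda>h. BS.forest_of h (verts G)) ` acyclic_orientations (verts G, connected_sets)"
    by blast
qed

text \<open>By injectivity, \<open>p\<close> produces the forest of \<open>g\<close> exactly if
  \<open>g\<close> is \<open>BS.leftmost p\<close>. Hence flips and rotations both mean distinctness
  together with permutations that differ by an adjacent transposition.\<close>

lemma flip_iff_rotation:
  assumes h: "h \<in> acyclic_orientations (verts G, connected_sets)"
    and h': "h' \<in> acyclic_orientations (verts G, connected_sets)"
  shows "(\<exists>i j. pair_flip (verts G, connected_sets) i j h h' \<or> pair_flip (verts G, connected_sets) i j h' h)
    \<longleftrightarrow> rotation G (BS.forest_of h (verts G)) (BS.forest_of h' (verts G))"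
proof -
  have inj: "BS.forest_of g (verts G) = BS.forest_of g' (verts G) \<longleftrightarrow> g = g'"
    if "g \<in> acyclic_orientations (verts G, connected_sets)"
      "g' \<in> acyclic_orientations (verts G, connected_sets)" for g g'
    using that by (rule inj_on_eq_iff[OF BS.forest_of_inj_on])
  have "permutation_forest p G (BS.forest_of g (verts G)) \<longleftrightarrow> g = BS.leftmost p"
    if "g \<in> acyclic_orientations (verts G, connected_sets)" "p \<in> permutations_of_set (verts G)" for g p
    using permutation_forest_iff[of "verts G" p] inj[OF that(1) BS.leftmost_acyclic_orientation] that(2)
    by simp
  then show ?thesis
    unfolding BS.flip_iff_transposition[OF h h'] rotation_def using inj h h' by blast
qed

end

section \<open>Isomorphisms between digraphs of vertex pairs\<close>

lemma digraph_iso_with_projI: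
  assumes "wf_digraph (with_proj X)" "bij_betw f (pverts X) (pverts Y)"
    and "\<And>u v. u \<in> pverts X \<Longrightarrow> v \<in> pverts X \<Longrightarrow> (u, v) \<in> parcs X \<longleftrightarrow> (f u, f v) \<in> parcs Y"
    and "parcs Y \<subseteq> pverts Y \<times> pverts Y"
  shows "digraph_iso (with_proj X) (with_proj Y)"
proof -
  \<comment> \<open>Arcs are pairs of vertices, so the vertex map \<open>f\<close> induces the arc
    map, and the projections are tail and head in the image.\<close>
  let ?f = "\<lparr> iso_verts = f, iso_arcs = map_prod f f, iso_head = snd, iso_tail = fst \<rparr>"
  have inj: "inj_on f (pverts X)" and img: "f ` pverts X = pverts Y"
    using assms(2) by (auto simp: bij_betw_def)
  have sub: "parcs X \<subseteq> pverts X \<times> pverts X"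
    using wf_digraph.wellformed[OF assms(1)] by (auto simp: mem_Times_iff)
  have "inj_on (map_prod f f) (parcs X)"
    using map_prod_inj_on[OF inj inj] sub by (rule inj_on_subset)
  then have "pre_digraph.digraph_isomorphism (with_proj X) ?f"
    using assms(1) inj by (simp add: pre_digraph.digraph_isomorphism_def)
  moreover have "parcs Y = map_prod f f ` parcs X"
  proof (intro equalityI subsetI)
    \<comment> \<open>Both ends of an arc of \<open>Y\<close> are images under \<open>f\<close>, so
      the arc pulls back to a pair of vertices of \<open>X\<close>.\<close>
    fix e assume e: "e \<in> parcs Y"
    then have "fst e \<in> f ` pverts X" "snd e \<in> f ` pverts X" using assms(4) img by auto
    then obtain u v where "u \<in> pverts X" "v \<in> pverts X" "e = (f u, f v)"
      by (metis imageE prod.collapse)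
    then show "e \<in> map_prod f f ` parcs X" using e assms(3) by force
  next
    fix e assume "e \<in> map_prod f f ` parcs X"
    then show "e \<in> parcs Y" using assms(3) sub by auto
  qed
  then have "with_proj Y = app_iso ?f (with_proj X)"
    using img by (intro pre_digraph.equality) auto
  ultimately show ?thesis unfolding digraph_iso_def by blast
qed

theorem lemma19:
  fixes G :: "('a, 'b) pre_digraph"
  assumes "graph G"
  shows "(\<exists>\<phi>. bij_betw \<phi> (acyclic_orientations (graphical_building_set G))
                 {F. elimination_forest G F}) \<and>
    digraph_iso (with_proj (flip_graph (graphical_building_set G)))
                (with_proj (rotation_graph G))"
proof -
  interpret graph G by fact
  \<comment> \<open>One map serves both claims.\<close>
  let ?\<phi> = "\<lambda>h. BS.forest_of h (verts G)"
  note bij = forest_of_bij_betw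
  have "digraph_iso (with_proj (flip_graph (graphical_building_set G))) (with_proj (rotation_graph G))"
  proof (rule digraph_iso_with_projI)
    show "wf_digraph (with_proj (flip_graph (graphical_building_set G)))"
      by unfold_locales (auto simp: flip_graph_def)
    show "bij_betw ?\<phi> (pverts (flip_graph (graphical_building_set G))) (pverts (rotation_graph G))"
      using bij by (simp add: flip_graph_def rotation_graph_def)
    show "parcs (rotation_graph G) \<subseteq> pverts (rotation_graph G) \<times> pverts (rotation_graph G)"
      by (auto simp: rotation_graph_def)
  next
    fix h h' assume "h \<in> pverts (flip_graph (graphical_building_set G))"
      "h' \<in> pverts (flip_graph (graphical_building_set G))"
    then show "(h, h') \<in> parcs (flip_graph (graphical_building_set G)) \<longleftrightarrow>
        (?\<phi> h, ?\<phi> h') \<in> parcs (rotation_graph G)"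
      using flip_iff_rotation[of h h'] bij_betwE[OF bij]
      by (simp add: flip_graph_def rotation_graph_def graphical_building_set_eq)
  qed
  with bij show ?thesis by blast
qed

end
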